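(* Let $B$ be a real Banach space with dual $B^*$ and let $C$ be a nonempty closed subset of $B$. Let $\phi\in B^*$ and $z\in C$. If there is $jz\in J(z)$ such that $$\langle\phi-jz,z-y\rangle\ge 0\quad\text{for all } y\in C,$$ then $z\in\pi_C(\phi)$.
   Context: $\langle\cdot,\cdot\rangle$ is the pairing between $B^*$ and $B$. The normalized duality map is $J(x)=\{\psi\in B^*:\langle\psi,x\rangle=\|\psi\|\|x\|=\|x\|^2=\|\psi\|^2\}$ for $x\in B$. $V(\phi,x)=\|\phi\|^2-2\langle\phi,x\rangle+\|x\|^2$ for $\phi\in B^*$, $x\in B$. The generalized projection is $\pi_C(\phi)=\{u\in C: V(\phi,u)=\inf_{y\in C}V(\phi,y)\}$ for $\phi\in B^*$ (possibly empty). *)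

theory Defs
  imports "HOL-Analysis.Analysis"
begin

text \<open>The dual space of a real Banach space is the type of bounded linear functionals with
  the operator norm; the duality pairing is application of the functional.\<close>

type_synonym 'a dual = "'a \<Rightarrow>\<^sub>L real"

definition pairing :: "'a::banach dual \<Rightarrow> 'a \<Rightarrow> real"
  where "pairing \<phi> x = blinfun_apply \<phi> x"

definition normalized_duality_map :: "'a::banach \<Rightarrow> 'a dual set"
  where "normalized_duality_map x =
    {\<psi>. pairing \<psi> x = norm \<psi> * norm x \<and> norm \<psi> * norm x = (norm x)\<^sup>2 \<and> (norm x)\<^sup>2 = (norm \<psi>)\<^sup>2}"

definition V :: "'a::banach dual \<Rightarrow> 'a \<Rightarrow> real"
  where "V \<phi> x = (norm \<phi>)\<^sup>2 - 2 * pairing \<phi> x + (norm x)\<^sup>2"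

text \<open>The infimum is a real one: \<open>V \<phi> y \<ge> (norm \<phi> - norm y)\<^sup>2 \<ge> 0\<close>, so it is the genuine
  greatest lower bound whenever \<open>C\<close> is nonempty; for empty \<open>C\<close> the set below is empty anyway.\<close>

definition generalized_projection :: "'a::banach set \<Rightarrow> 'a dual \<Rightarrow> 'a set"
  where "generalized_projection C \<phi> = {u \<in> C. V \<phi> u = (INF y\<in>C. V \<phi> y)}"

end

theory Submission
  imports Defs
begin

text \<open>Twice a duality functional \<open>jz\<close> is a subgradient of the squared norm at z.
  Hence V \<phi> y - V \<phi> z, which is |y|^2 - |z|^2 - 2 <\<phi>, y - z>, is at least 2 <\<phi> -
  jz, z - y>, and the variational inequality makes this nonnegative on C.\<close>

text \<open>Since \<psi> has the norm of x and attains it at x, the operator norm bound on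
  \<open>pairing \<psi> y\<close> and 2ab \<le> a^2 + b^2 with a = |x|, b = |y| suffice.\<close>

lemma duality_map_subgradient:
  fixes x y :: "'a::banach"
  assumes "\<psi> \<in> normalized_duality_map x"
  shows "(norm x)\<^sup>2 + 2 * pairing \<psi> (y - x) \<le> (norm y)\<^sup>2"
proof -
  have nrm: "norm \<psi> = norm x" and px: "pairing \<psi> x = (norm x)\<^sup>2"
    using assms by (auto simp: normalized_duality_map_def)
  have "pairing \<psi> y \<le> norm x * norm y"
    using norm_blinfun[of \<psi> y] by (simp add: pairing_def nrm)
  moreover have "0 \<le> (norm x - norm y)\<^sup>2"
    by simp
  moreover have "pairing \<psi> (y - x) = pairing \<psi> y - (norm x)\<^sup>2"
    by (simp add: px[symmetric] pairing_def blinfun.diff_right)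
  ultimately show ?thesis
    by (simp add: power2_diff)
qed

theorem theorem2p10:
  fixes C :: "'a::banach set" and \<phi> :: "'a dual" and z :: 'a
  assumes "C \<noteq> {}" and "closed C" and "z \<in> C"
    and "\<exists>jz \<in> normalized_duality_map z. \<forall>y\<in>C. pairing (\<phi> - jz) (z - y) \<ge> 0"
  shows "z \<in> generalized_projection C \<phi>"
proof -
  obtain jz where jz: "jz \<in> normalized_duality_map z"
    and var: "\<And>y. y \<in> C \<Longrightarrow> pairing (\<phi> - jz) (z - y) \<ge> 0"
    using assms(4) by blast
  \<comment> \<open>Twice the variational inequality is added to the subgradient inequality at z;
    the \<open>jz\<close> terms cancel.\<close>
  have "V \<phi> z \<le> V \<phi> y" if "y \<in> C" for y
    using var[OF that] duality_map_subgradient[OF jz, of y]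
    by (simp add: V_def pairing_def blinfun.diff_left blinfun.diff_right)
  \<comment> \<open>The infimum is attained at z, so boundedness below comes for free.\<close>
  then have "(INF y\<in>C. V \<phi> y) = V \<phi> z"
    using \<open>z \<in> C\<close> by (intro cInf_eq_minimum) auto
  then show ?thesis
    using \<open>z \<in> C\<close> by (simp add: generalized_projection_def)
qed

end
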